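(* $\alpha(n,3) = o(n)$, i.e. $\alpha(n,3)/n \to 0$ as $n\to\infty$.
   Context: A finite set of points in $\mathbb{R}^d$ is in general position if no hyperplane contains more than $d$ of its points. For a finite set $P\subset\mathbb{R}^d$ in which at most $d+1$ points lie on any hyperplane, $\alpha(P)$ denotes the maximum size of a subset of $P$ in general position, and $\alpha(n,d)=\min\{\alpha(P): P\subset\mathbb{R}^d,\ |P|=n,\ \text{at most } d+1 \text{ points of } P \text{ on any hyperplane}\}$. Thus $\alpha(n,3)$ is the minimum, over $n$-point sets in $\mathbb{R}^3$ with no five points on a plane, of the largest subset with no four coplanar points. *)

theory Defs
  imports "HOL-Analysis.Analysis" "HOL-Library.Landau_Symbols"
begin

definition at_most_on_hyperplane :: "nat \<Rightarrow> (real ^ 'd) set \<Rightarrow> bool" where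
  "at_most_on_hyperplane k S \<longleftrightarrow>
     finite S \<and> (\<forall>a b. a \<noteq> 0 \<longrightarrow> card (S \<inter> {x. a \<bullet> x = b}) \<le> k)"

definition general_position :: "(real ^ 'd) set \<Rightarrow> bool" where
  "general_position S \<longleftrightarrow> at_most_on_hyperplane CARD('d) S"

text \<open>Only meaningful for finite \<open>P\<close>; the maximum is then over a finite set of
  values containing \<open>card {}\<close>.\<close>

definition alpha_set :: "(real ^ 'd) set \<Rightarrow> nat" where
  "alpha_set P = Max {card Q | Q. Q \<subseteq> P \<and> general_position Q}"

text \<open>The dimension is passed as a type: \<open>alpha n TYPE(3)\<close> renders \<open>\<alpha>(n,3)\<close>.
  The set of values is bounded by \<open>n\<close>, and it is nonempty because \<open>n\<close> points
  on the moment curve satisfy the hyperplane condition.\<close>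

definition alpha :: "nat \<Rightarrow> 'd::finite itself \<Rightarrow> nat" where
  "alpha n D = Min {alpha_set P | P :: (real ^ 'd) set.
     card P = n \<and> at_most_on_hyperplane (CARD('d) + 1) P}"

end

theory Submission
  imports Defs "HOL-Real_Asymp.Real_Asymp"
begin

text \<open>
  Take \<open>P\<^sub>k = {\<Sum>i\<in>I. w\<^sub>i | I \<subseteq> {1..k}}\<close>, a generic projection of the cube \<open>{0,1}\<^sup>k\<close>
  to space. Building it one doubling \<open>P \<union> (P + w)\<close> at a time, with \<open>w\<close> outside finitely many planes,
  no three points are collinear and no five are coplanar: a plane containing three points of one half
  is spanned by them and misses the other half. On the other hand \<open>P\<^sub>k + P\<^sub>k\<close> has at
  most \<open>3\<^sup>k\<close> elements, and two distinct pairs with the same sum \<open>a + b = c + d\<close> form a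
  parallelogram. Hence a subset of size \<open>q\<close> in general position has
  \<open>q (q - 1) / 2 \<le> 3\<^sup>k\<close>, which is a power saving against \<open>2\<^sup>k\<close>.
\<close>

section \<open>Planes through three points and generic translations\<close>

lemma affine_hull_3_in_hyperplane:
  fixes a b c :: "'a::euclidean_space"
  assumes "DIM('a) \<ge> 3"
  obtains n r where "n \<noteq> 0" "affine hull {a, b, c} \<subseteq> {x. n \<bullet> x = r}"
proof -
  have "dim {b - a, c - a} \<le> card {b - a, c - a}"
    by (intro dim_le_card') auto
  also have "\<dots> \<le> 2"
    by (simp add: card_insert_if)
  finally have "dim {b - a, c - a} < DIM('a)" using assms by simp
  then obtain n where n: "n \<noteq> 0" "\<And>y. y \<in> span {b - a, c - a} \<Longrightarrow> orthogonal n y"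
    using orthogonal_to_subspace_exists by blast
  have "n \<bullet> (b - a) = 0" "n \<bullet> (c - a) = 0"
    using n(2)[of "b - a"] n(2)[of "c - a"] by (auto simp: span_base orthogonal_def)
  hence "affine hull {a, b, c} \<subseteq> {x. n \<bullet> x = n \<bullet> a}"
    by (intro hull_minimal affine_hyperplane) (auto simp: inner_diff_right)
  with n(1) that show thesis by blast
qed

text \<open>Each instance of a condition confines the bad \<open>w\<close> to a hyperplane, which is
  a null set, and finitely many null sets do not cover the space. Repeated points are allowed on
  purpose: later uses degenerate the hull to a line or a single point.\<close>

lemma generic_translation:
  fixes P :: "'a::euclidean_space set"
  assumes "finite P" "DIM('a) \<ge> 3"
  obtains w where
    "\<And>a b c d. {a, b, c, d} \<subseteq> P \<Longrightarrow> d + w \<notin> affine hull {a, b, c}"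
    "\<And>a b c d. {a, b, c, d} \<subseteq> P \<Longrightarrow> d - w \<notin> affine hull {a, b, c}"
proof -
  define B where "B = (\<lambda>(a, b, c, d). {w. d + w \<in> affine hull {a, b, c :: 'a}} \<union>
    {w. d - w \<in> affine hull {a, b, c}})"
  have neg: "negligible (B (a, b, c, d))" for a b c d
  proof -
    obtain n r where n: "n \<noteq> 0" "affine hull {a, b, c} \<subseteq> {x. n \<bullet> x = r}"
      using affine_hull_3_in_hyperplane[OF assms(2)] by blast
    have "B (a, b, c, d) \<subseteq> {x. n \<bullet> x = r - n \<bullet> d} \<union> {x. n \<bullet> x = n \<bullet> d - r}"
      using n(2) by (fastforce simp: B_def inner_add_right inner_diff_right)
    moreover have "negligible ({x. n \<bullet> x = r - n \<bullet> d} \<union> {x. n \<bullet> x = n \<bullet> d - r})"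
      using n(1) by (intro negligible_Un negligible_hyperplane) auto
    ultimately show ?thesis by (rule negligible_subset[rotated])
  qed
  have "negligible (\<Union>(B ` (P \<times> P \<times> P \<times> P)))"
    using assms(1) neg by (intro negligible_Union) auto
  hence "\<Union>(B ` (P \<times> P \<times> P \<times> P)) \<noteq> UNIV" by auto
  then obtain w where "w \<notin> \<Union>(B ` (P \<times> P \<times> P \<times> P))" by blast
  thus thesis by (intro that[of w]) (auto simp: B_def)
qed

text \<open>Three non-collinear points have a hull of affine dimension at least 2, the dimension of
  the plane, and nested affine sets of equal dimension coincide.\<close>

lemma plane_eq_affine_hull:
  fixes a b c n :: "'a::euclidean_space"
  assumes "DIM('a) = 3" "n \<noteq> 0" "\<not> collinear {a, b, c}" "{a, b, c} \<subseteq> {x. n \<bullet> x = r}"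
  shows "{x. n \<bullet> x = r} = affine hull {a, b, c}"
proof -
  have sub: "affine hull {a, b, c} \<subseteq> {x. n \<bullet> x = r}"
    using assms(4) by (intro hull_minimal affine_hyperplane)
  have "aff_dim (affine hull {a, b, c}) \<ge> 2"
    using assms(3) by (simp add: collinear_aff_dim)
  moreover have "aff_dim (affine hull {a, b, c}) \<le> aff_dim {x. n \<bullet> x = r}"
    using sub by (rule aff_dim_subset)
  ultimately have "aff_dim (affine hull {a, b, c}) = aff_dim {x. n \<bullet> x = r}"
    using assms(1,2) by simp
  thus ?thesis
    using affine_dim_equal[OF affine_affine_hull affine_hyperplane _ sub] by simp
qed

section \<open>One doubling step: collinearity, coplanarity and the sumset\<close>

lemma doubling_no_three_collinear:
  fixes P :: "'a::euclidean_space set"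
  assumes P: "\<And>a b c. {a, b, c} \<subseteq> P \<Longrightarrow> distinct [a, b, c] \<Longrightarrow> \<not> collinear {a, b, c}"
    and w1: "\<And>a b c d. {a, b, c, d} \<subseteq> P \<Longrightarrow> d + w \<notin> affine hull {a, b, c}"
    and w2: "\<And>a b c d. {a, b, c, d} \<subseteq> P \<Longrightarrow> d - w \<notin> affine hull {a, b, c}"
    and abc: "{a, b, c} \<subseteq> P \<union> (+) w ` P" "distinct [a, b, c]"
  shows "\<not> collinear {a, b, c}"
proof -
  have shift: "collinear {w + x, w + y, w + z} \<longleftrightarrow> collinear {x, y, z}" for x y z :: 'a
    by (simp add: collinear_def)
  \<comment> \<open>Three points inside one half are settled by \<open>P\<close> and translation
    invariance; otherwise they split two to one. Repeating \<open>y\<close> turns the hull into the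
    line through \<open>x\<close> and \<open>y\<close>, which \<open>z + w\<close> avoids.\<close>
  have two_one: "\<not> collinear {x, y, w + z}" if "{x, y, z} \<subseteq> P" "x \<noteq> y" for x y z
    using w1[of x y y z] that by (simp add: collinear_3_affine_hull add.commute)
  \<comment> \<open>Translating by \<open>- w\<close> brings the pair back to \<open>P\<close> and
    sends \<open>z\<close> to \<open>z - w\<close>, so the second genericity condition
    applies.\<close>
  have one_two: "\<not> collinear {w + x, w + y, z}" if "{x, y, z} \<subseteq> P" "x \<noteq> y" for x y z
    using w2[of x y y z] that shift[of x y "z - w"] by (simp add: collinear_3_affine_hull)
  have perm: "{a, b, c} = {b, c, a}" "{a, b, c} = {a, c, b}" by auto
  consider (PP) "a \<in> P" "b \<in> P" | (PQ) "a \<in> P" "b \<in> (+) w ` P" | (QP) "a \<in> (+) w ` P" "b \<in> P"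
    | (QQ) "a \<in> (+) w ` P" "b \<in> (+) w ` P" using abc by auto
  thus ?thesis
  proof cases
    case PP
    thus ?thesis using P[of a b c] two_one[of a b] abc by auto
  next
    case PQ
    show ?thesis
    proof (cases "c \<in> P")
      case True
      thus ?thesis unfolding perm(2) using PQ two_one[of a c] abc(2) by auto
    next
      case False
      thus ?thesis unfolding perm(1) using PQ one_two[of _ _ a] abc by auto
    qed
  next
    case QP
    show ?thesis
    proof (cases "c \<in> P")
      case True
      thus ?thesis unfolding perm(1) using QP two_one[of b c] abc(2) by auto
    next
      case False
      thus ?thesis unfolding perm(2) using QP one_two[of _ _ b] abc by auto
    qed
  next
    case QQ
    thus ?thesis using P one_two[of _ _ c] abc by (auto simp: shift)
  qed
qed

text \<open>Three points of \<open>P\<close> on the plane span it, so a translated point on it would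
  lie in their affine hull. The translation vector is free, so that both \<open>w\<close> and
  \<open>- w\<close> can be inserted.\<close>

lemma plane_meets_one_half:
  fixes P :: "'a::euclidean_space set"
  assumes "DIM('a) = 3" "finite P" "n \<noteq> 0"
    and P: "\<And>a b c. {a, b, c} \<subseteq> P \<Longrightarrow> distinct [a, b, c] \<Longrightarrow> \<not> collinear {a, b, c}"
    and w: "\<And>a b c d. {a, b, c, d} \<subseteq> P \<Longrightarrow> d + w \<notin> affine hull {a, b, c}"
    and card: "card (P \<inter> {x. n \<bullet> x = r}) \<ge> 3"
  shows "((\<lambda>x. x + w) ` P) \<inter> {x. n \<bullet> x = r} = {}"
proof -
  obtain T where "T \<subseteq> P \<inter> {x. n \<bullet> x = r}" "card T = 3"
    using card by (meson obtain_subset_with_card_n)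
  then obtain a b c where "{a, b, c} \<subseteq> P \<inter> {x. n \<bullet> x = r}" "distinct [a, b, c]"
    by (auto simp: card_3_iff)
  moreover from this have "{x. n \<bullet> x = r} = affine hull {a, b, c}"
    using assms by (intro plane_eq_affine_hull) auto
  ultimately show ?thesis using w[of a b c] by auto
qed

text \<open>Points in the second half are counted in \<open>P\<close> on the parallel plane with
  offset \<open>r - n \<bullet> w\<close>. If one half contributes at least three points, the other
  contributes none and the bound for \<open>P\<close> applies; otherwise the count is at most 2 +
  2.\<close>

lemma doubling_at_most_4_on_plane:
  fixes P :: "(real ^ 3) set"
  assumes "at_most_on_hyperplane 4 P"
    and P: "\<And>a b c. {a, b, c} \<subseteq> P \<Longrightarrow> distinct [a, b, c] \<Longrightarrow> \<not> collinear {a, b, c}"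
    and w1: "\<And>a b c d. {a, b, c, d} \<subseteq> P \<Longrightarrow> d + w \<notin> affine hull {a, b, c}"
    and w2: "\<And>a b c d. {a, b, c, d} \<subseteq> P \<Longrightarrow> d - w \<notin> affine hull {a, b, c}"
  shows "at_most_on_hyperplane 4 (P \<union> (+) w ` P)"
  unfolding at_most_on_hyperplane_def
proof (intro conjI allI impI)
  have fin: "finite P" and four: "\<And>n r. n \<noteq> 0 \<Longrightarrow> card (P \<inter> {x. n \<bullet> x = r}) \<le> 4"
    using assms(1) by (auto simp: at_most_on_hyperplane_def)
  show "finite (P \<union> (+) w ` P)" using fin by simp
  fix n :: "real ^ 3" and r assume n: "n \<noteq> 0"
  let ?A = "P \<inter> {x. n \<bullet> x = r}" and ?B = "P \<inter> {x. n \<bullet> x = r - n \<bullet> w}"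
  have half: "(+) w ` P \<inter> {x. n \<bullet> x = r} = (+) w ` ?B"
    by (auto simp: inner_add_right)
  have "card ((P \<union> (+) w ` P) \<inter> {x. n \<bullet> x = r}) = card (?A \<union> (+) w ` ?B)"
    by (simp add: Int_Un_distrib2 half)
  also have "\<dots> \<le> card ?A + card ((+) w ` ?B)" by (rule card_Un_le)
  also have "\<dots> = card ?A + card ?B" by (simp add: card_image)
  also have "\<dots> \<le> 4"
  proof -
    have "card ?B = 0" if "card ?A \<ge> 3"
    proof -
      have "((\<lambda>x. x + w) ` P) \<inter> {x. n \<bullet> x = r} = {}"
        using n fin P w1 that by (intro plane_meets_one_half) auto
      hence "?B = {}" by (auto simp: inner_add_right)
      thus ?thesis by simp
    qed
    moreover have "card ?A = 0" if "card ?B \<ge> 3"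
    proof -
      \<comment> \<open>The configuration is seen from the second half: after translation by
        \<open>- w\<close>, that half becomes \<open>P\<close> and the first becomes
        \<open>P\<close> shifted by \<open>- w\<close>.\<close>
      have "((\<lambda>x. x + (- w)) ` P) \<inter> {x. n \<bullet> x = r - n \<bullet> w} = {}"
        using n fin P w2 that by (intro plane_meets_one_half) auto
      hence "?A = {}" by (auto simp: inner_diff_right)
      thus ?thesis by simp
    qed
    ultimately show ?thesis using four[OF n, of r] four[OF n, of "r - n \<bullet> w"] by linarith
  qed
  finally show "card ((P \<union> (+) w ` P) \<inter> {x. n \<bullet> x = r}) \<le> 4" .
qed

text \<open>The two kinds of mixed sums agree, so only three translates of the old sumset occur, by
  0, \<open>w\<close> and \<open>w + w\<close>.\<close>

lemma card_sums_doubling: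
  fixes P :: "'a::ab_group_add set"
  assumes "finite P"
  shows "card ((\<lambda>(x, y). x + y) ` ((P \<union> (+) w ` P) \<times> (P \<union> (+) w ` P)))
    \<le> 3 * card ((\<lambda>(x, y). x + y) ` (P \<times> P))"
proof -
  let ?S = "(\<lambda>(x, y). x + y) ` (P \<times> P)"
  have "(\<lambda>(x, y). x + y) ` ((P \<union> (+) w ` P) \<times> (P \<union> (+) w ` P))
      \<subseteq> ?S \<union> (+) w ` ?S \<union> (+) (w + w) ` ?S" (is "?L \<subseteq> ?R")
  proof (rule image_subsetI)
    fix p assume "p \<in> (P \<union> (+) w ` P) \<times> (P \<union> (+) w ` P)"
    thus "(case p of (x, y) \<Rightarrow> x + y) \<in> ?R"
      by (elim SigmaE UnE imageE) (force simp: image_iff algebra_simps)+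
  qed
  hence "card ?L \<le> card ?R" using assms by (intro card_mono) auto
  also have "\<dots> \<le> card (?S \<union> (+) w ` ?S) + card ((+) (w + w) ` ?S)" by (rule card_Un_le)
  also have "\<dots> \<le> card ?S + card ((+) w ` ?S) + card ((+) (w + w) ` ?S)"
    by (intro add_right_mono card_Un_le)
  also have "\<dots> = 3 * card ?S" by (simp add: card_image)
  finally show ?thesis .
qed

text \<open>Non-collinearity is carried through the induction because the coplanarity bound needs
  three points on a plane to span it.\<close>

lemma generic_cube_exists:
  "\<exists>P :: (real ^ 3) set. card P = 2 ^ k \<and> at_most_on_hyperplane 4 P \<and>
     (\<forall>a b c. {a, b, c} \<subseteq> P \<longrightarrow> distinct [a, b, c] \<longrightarrow> \<not> collinear {a, b, c}) \<and>
     card ((\<lambda>(x, y). x + y) ` (P \<times> P)) \<le> 3 ^ k"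
proof (induction k)
  case 0
  have "card ({0} \<inter> {x. a \<bullet> x = b}) \<le> 4" for a :: "real ^ 3" and b
    using card_mono[of "{0 :: real ^ 3}" "{0} \<inter> {x. a \<bullet> x = b}"] by simp
  thus ?case by (intro exI[of _ "{0}"]) (auto simp: at_most_on_hyperplane_def)
next
  case (Suc k)
  then obtain P :: "(real ^ 3) set" where P: "card P = 2 ^ k" "at_most_on_hyperplane 4 P"
     "\<And>a b c. {a, b, c} \<subseteq> P \<Longrightarrow> distinct [a, b, c] \<Longrightarrow> \<not> collinear {a, b, c}"
     "card ((\<lambda>(x, y). x + y) ` (P \<times> P)) \<le> 3 ^ k" by blast
  have fin: "finite P" using P(2) by (simp add: at_most_on_hyperplane_def)
  obtain w where w: "\<And>a b c d. {a, b, c, d} \<subseteq> P \<Longrightarrow> d + w \<notin> affine hull {a, b, c}"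
    "\<And>a b c d. {a, b, c, d} \<subseteq> P \<Longrightarrow> d - w \<notin> affine hull {a, b, c}"
    using generic_translation[OF fin] by auto
  have "P \<inter> (+) w ` P = {}"
  proof -
    have False if "w + d \<in> P" "d \<in> P" for d
      \<comment> \<open>With all three points equal the hull is the single point
        \<open>w + d\<close>, so the condition makes the two halves disjoint.\<close>
      using w(1)[of "w + d" "w + d" "w + d" d] that by (simp add: add.commute)
    thus ?thesis by auto
  qed
  hence "card (P \<union> (+) w ` P) = 2 ^ Suc k"
    using fin P(1) by (simp add: card_Un_disjoint card_image)
  moreover have "at_most_on_hyperplane 4 (P \<union> (+) w ` P)"
    using P(2,3) w by (rule doubling_at_most_4_on_plane)
  moreover have "\<not> collinear {a, b, c}" if "{a, b, c} \<subseteq> P \<union> (+) w ` P" "distinct [a, b, c]" for a b c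
    using P(3) w that by (rule doubling_no_three_collinear)
  moreover have "card ((\<lambda>(x, y). x + y) ` ((P \<union> (+) w ` P) \<times> (P \<union> (+) w ` P))) \<le> 3 ^ Suc k"
    using card_sums_doubling[OF fin, of w] P(4) by simp
  ultimately show ?case by blast
qed

section \<open>Parallelograms and sums of pairs in general position\<close>

lemma general_position_no_parallelogram:
  fixes a b c d :: "real ^ 3"
  assumes Q: "general_position Q" and mem: "{a, b, c, d} \<subseteq> Q"
    and dist: "distinct [a, b, c, d]" and sum: "a + b = c + d"
  shows False
proof -
  \<comment> \<open>Since d = a + b - c is an affine combination, any plane through
    \<open>a\<close>, \<open>b\<close>, \<open>c\<close> also contains \<open>d\<close>, which puts
    four points on it.\<close>
  obtain n r where n: "n \<noteq> 0" "affine hull {a, b, c} \<subseteq> {x. n \<bullet> x = r}"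
    by (rule affine_hull_3_in_hyperplane[of a b c]) auto
  have abc: "n \<bullet> a = r" "n \<bullet> b = r" "n \<bullet> c = r"
    using n(2) hull_subset[of "{a, b, c}" affine] by auto
  moreover have "n \<bullet> a + n \<bullet> b = n \<bullet> c + n \<bullet> d"
    using sum by (metis inner_add_right)
  ultimately have "{a, b, c, d} \<subseteq> Q \<inter> {x. n \<bullet> x = r}" using mem by auto
  moreover have "finite Q" "card (Q \<inter> {x. n \<bullet> x = r}) \<le> 3"
    using Q n(1) by (auto simp: general_position_def at_most_on_hyperplane_def)
  ultimately have "card {a, b, c, d} \<le> 3"
    by (meson card_mono finite_Int le_trans)
  thus False using dist by simp
qed

text \<open>Without parallelograms, a two-element subset of \<open>Q\<close> is determined by its
  sum, so these subsets inject into the sumset of \<open>P\<close>.\<close>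

lemma general_position_choose_2_le_card_sums:
  fixes Q :: "(real ^ 3) set"
  assumes Q: "general_position Q" "Q \<subseteq> P" and fin: "finite P"
  shows "card Q choose 2 \<le> card ((\<lambda>(x, y). x + y) ` (P \<times> P))"
proof -
  let ?X = "{X. X \<subseteq> Q \<and> card X = 2}"
  have "inj_on (\<lambda>X. \<Sum>X) ?X"
  proof (rule inj_onI)
    fix X Y assume XY: "X \<in> ?X" "Y \<in> ?X" "\<Sum>X = \<Sum>Y"
    then obtain a b c d where ab: "X = {a, b}" "a \<noteq> b" and cd: "Y = {c, d}" "c \<noteq> d"
      by (auto simp: card_2_iff)
    have sum: "a + b = c + d" using XY(3) ab cd by simp
    show "X = Y"
    proof (cases "distinct [a, b, c, d]")
      case True
      thus ?thesis using general_position_no_parallelogram[OF Q(1) _ True sum] XY ab cd by auto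
    next
      case False
      \<comment> \<open>A coincidence must be between the two pairs; cancelling the shared point
        identifies the remaining ones.\<close>
      hence "(a = c \<and> b = d) \<or> (a = d \<and> b = c)"
        using ab cd sum by (auto simp: add.commute)
      thus ?thesis using ab cd by auto
    qed
  qed
  moreover have "(\<lambda>X. \<Sum>X) ` ?X \<subseteq> (\<lambda>(x, y). x + y) ` (P \<times> P)"
    using Q(2) by (force simp: card_2_iff)
  ultimately have "card ?X \<le> card ((\<lambda>(x, y). x + y) ` (P \<times> P))"
    using fin by (intro card_inj_on_le) auto
  thus ?thesis using n_subsets[OF finite_subset[OF Q(2) fin]] by simp
qed

section \<open>The extremal function and its growth\<close>

lemma alpha_set_attained:
  assumes "finite P"
  obtains Q where "Q \<subseteq> P" "general_position Q" "alpha_set P = card Q"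
proof -
  let ?C = "{card Q | Q. Q \<subseteq> P \<and> general_position Q}"
  have "?C \<subseteq> card ` Pow P" by auto
  hence "finite ?C" using assms by (meson finite_Pow_iff finite_imageI finite_subset)
  moreover have "general_position {}"
    by (simp add: general_position_def at_most_on_hyperplane_def)
  hence "?C \<noteq> {}" by blast
  ultimately have "Max ?C \<in> ?C" by (rule Max_in)
  thus thesis using that by (auto simp: alpha_set_def)
qed

lemma alpha_le_alpha_set:
  fixes P :: "(real ^ 'd) set"
  assumes "at_most_on_hyperplane (CARD('d) + 1) P"
  shows "alpha (card P) TYPE('d) \<le> alpha_set P"
  unfolding alpha_def
proof (rule Min_le)
  \<comment> \<open>This bound makes the set of values finite, as \<open>Min_le\<close>
    requires.\<close>
  have "alpha_set S \<le> card P"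
    if S: "card S = card P" "at_most_on_hyperplane (CARD('d) + 1) S" for S :: "(real ^ 'd) set"
  proof -
    have fin: "finite S" using S(2) by (simp add: at_most_on_hyperplane_def)
    obtain Q where "Q \<subseteq> S" "alpha_set S = card Q" by (rule alpha_set_attained[OF fin])
    thus ?thesis using card_mono[OF fin, of Q] S(1) by simp
  qed
  hence "{alpha_set S | S :: (real ^ 'd) set. card S = card P \<and>
      at_most_on_hyperplane (CARD('d) + 1) S} \<subseteq> {..card P}" by auto
  thus "finite {alpha_set S | S :: (real ^ 'd) set. card S = card P \<and>
      at_most_on_hyperplane (CARD('d) + 1) S}" by (rule finite_subset) simp
qed (use assms in auto)

lemma at_most_on_hyperplane_subset:
  assumes "at_most_on_hyperplane k P" "S \<subseteq> P"
  shows "at_most_on_hyperplane k S"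
  unfolding at_most_on_hyperplane_def
proof (intro conjI allI impI)
  have fin: "finite P" using assms(1) by (simp add: at_most_on_hyperplane_def)
  thus "finite S" using assms(2) finite_subset by blast
  fix a b assume "a \<noteq> (0 :: real ^ 'a)"
  hence "card (P \<inter> {x. a \<bullet> x = b}) \<le> k"
    using assms(1) by (simp add: at_most_on_hyperplane_def)
  moreover have "card (S \<inter> {x. a \<bullet> x = b}) \<le> card (P \<inter> {x. a \<bullet> x = b})"
    using fin assms(2) by (intro card_mono) auto
  ultimately show "card (S \<inter> {x. a \<bullet> x = b}) \<le> k" by simp
qed

text \<open>For sizes that are not powers of 2, any \<open>n\<close> points of the cube serve: they
  inherit the hyperplane condition, and the sumset of the whole cube still bounds the pairs.\<close>

lemma alpha_3_choose_2_le:
  assumes "n \<le> 2 ^ k"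
  shows "alpha n TYPE(3) choose 2 \<le> 3 ^ k"
proof -
  obtain P :: "(real ^ 3) set" where P: "card P = 2 ^ k" "at_most_on_hyperplane 4 P"
      "card ((\<lambda>(x, y). x + y) ` (P \<times> P)) \<le> 3 ^ k"
    using generic_cube_exists by blast
  have fin: "finite P" using P(2) by (simp add: at_most_on_hyperplane_def)
  obtain S where S: "S \<subseteq> P" "card S = n"
    using assms P(1) by (metis obtain_subset_with_card_n)
  obtain Q where Q: "Q \<subseteq> S" "general_position Q" "alpha_set S = card Q"
    using alpha_set_attained finite_subset[OF S(1) fin] by blast
  have "alpha n TYPE(3) \<le> card Q"
    using alpha_le_alpha_set[of S] at_most_on_hyperplane_subset[OF P(2) S(1)] S(2) Q(3) by simp
  hence "alpha n TYPE(3) choose 2 \<le> card Q choose 2" by (rule binomial_right_mono)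
  also have "\<dots> \<le> 3 ^ k"
    using general_position_choose_2_le_card_sums[of Q P] Q S fin P(3) by fastforce
  finally show ?thesis .
qed

text \<open>The least \<open>k\<close> with n \<le> 2^k loses only a factor 2. The exponent 4/5 is
  half of 8/5, a convenient rational between log_2 3 and 2.\<close>

lemma alpha_3_le_powr:
  assumes "n \<ge> 1"
  shows "real (alpha n TYPE(3)) \<le> 1 + sqrt 2 * (2 * real n) powr (4 / 5)"
proof -
  define q where "q = alpha n TYPE(3)"
  obtain k where k: "n \<le> 2 ^ k" "2 ^ k \<le> 2 * n"
  proof -
    define k where "k = (LEAST k. n \<le> 2 ^ k)"
    have "n \<le> 2 ^ n" by (simp add: less_imp_le)
    hence "n \<le> 2 ^ k" unfolding k_def by (rule LeastI)
    moreover have "2 ^ k \<le> 2 * n"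
    proof (cases k)
      case 0
      thus ?thesis using assms by simp
    next
      case (Suc j)
      hence "\<not> n \<le> 2 ^ j" using not_less_Least[of j "\<lambda>k. n \<le> 2 ^ k"] by (simp add: k_def)
      thus ?thesis using Suc by simp
    qed
    ultimately show thesis using that by blast
  qed
  have "q * (q - 1) = 2 * (q choose 2)"
    by (cases q) (simp_all add: choose_two)
  also have "\<dots> \<le> 2 * 3 ^ k"
    using alpha_3_choose_2_le[OF k(1)] by (simp add: q_def)
  finally have "q * (q - 1) \<le> 2 * 3 ^ k" .
  \<comment> \<open>Passing to a perfect square allows a square root later; truncated subtraction
    does no harm at \<open>q = 0\<close>, since q \<le> 1 + (q - 1) still holds.\<close>
  hence "(q - 1) * (q - 1) \<le> 2 * 3 ^ k"
    by (meson diff_le_self le_trans mult_le_mono1)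
  hence "real ((q - 1) * (q - 1)) \<le> real (2 * 3 ^ k)"
    by (rule of_nat_mono)
  hence sq: "(real (q - 1))\<^sup>2 \<le> 2 * 3 ^ k"
    by (simp add: power2_eq_square)
  \<comment> \<open>This is 243 \<le> 256 = 2^8.\<close>
  have "(3 :: real) ^ 5 \<le> (2 powr (8 / 5)) ^ 5"
    by (simp add: powr_power)
  hence "(3 :: real) \<le> 2 powr (8 / 5)"
    \<comment> \<open>The rule compares powers with exponent \<open>Suc n\<close>, so 4 stands for
      fifth powers.\<close>
    by (rule power_le_imp_le_base[of _ 4, simplified]) simp_all
  hence "(3 :: real) ^ k \<le> (2 powr (8 / 5)) ^ k" by (rule power_mono) simp
  also have "\<dots> = 2 powr (8 / 5 * real k)"
    by (simp add: powr_power mult.commute)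
  also have "\<dots> = (2 powr real k) powr (8 / 5)"
    by (simp only: powr_powr mult.commute)
  also have "\<dots> \<le> (2 * real n) powr (8 / 5)"
  proof (rule powr_mono2)
    have "real (2 ^ k) \<le> real (2 * n)" using k(2) by (rule of_nat_mono)
    thus "2 powr real k \<le> 2 * real n" by (simp add: powr_realpow)
  qed simp_all
  also have "\<dots> = ((2 * real n) powr (4 / 5))\<^sup>2"
    by (simp add: power2_eq_square flip: powr_add)
  finally have "2 * 3 ^ k \<le> (sqrt 2 * (2 * real n) powr (4 / 5))\<^sup>2"
    by (simp add: power_mult_distrib)
  with sq have "(real (q - 1))\<^sup>2 \<le> (sqrt 2 * (2 * real n) powr (4 / 5))\<^sup>2" by linarith
  hence "real (q - 1) \<le> sqrt 2 * (2 * real n) powr (4 / 5)"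
    by (rule power2_le_imp_le) simp
  thus ?thesis unfolding q_def by linarith
qed

theorem theorem5:
  "(\<lambda>n. real (alpha n TYPE(3))) \<in> o(\<lambda>n. real n)"
proof -
  have "(\<lambda>n. real (alpha n TYPE(3))) \<in> O(\<lambda>n. 1 + sqrt 2 * (2 * real n) powr (4 / 5))"
    using alpha_3_le_powr
    by (intro landau_o.big_mono eventually_mono[OF eventually_ge_at_top[of 1]]) fastforce
  also have "(\<lambda>n. 1 + sqrt 2 * (2 * real n) powr (4 / 5)) \<in> o(\<lambda>n. real n)"
    by real_asymp
  finally show ?thesis .
qed

end
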